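(* Let $K\subset\mathbb{R}^n$ be an $n$-dimensional convex polyhedron such that the dimension of its recession cone $\vec{\mathcal C}(K)$ is strictly smaller than $n$. Then both $K$ and $\operatorname{Int}(K)$ have bounded non-singleton projections. Consequently, under these hypotheses, neither $K$ nor $\operatorname{Int}(K)$ is a polynomial image of $\mathbb{R}^m$ for any $m\ge 1$.
   Context: A convex polyhedron $K\subset\mathbb{R}^n$ is a (nonempty) finite intersection of closed affine half-spaces. Its dimension is the dimension of the smallest affine subspace containing it, and $\operatorname{Int}(K)$ is its relative interior in that affine subspace. The recession cone of $K$ is $\vec{\mathcal C}(K):=\{\vec v\in\mathbb{R}^n:\ p+\lambda\vec v\in K\ \text{for all}\ \lambda\ge 0\}$, where $p\in K$ is any point (the set does not depend on $p$). A projection of a set $S\subset\mathbb{R}^n$ is its image under the orthogonal projection of $\mathbb{R}^n$ onto some nonzero linear subspace; "bounded non-singleton" means that this image is a bounded set with more than one point. A set $S\subset\mathbb{R}^n$ is a polynomial image of $\mathbb{R}^m$ if there is a map $f:\mathbb{R}^m\to\mathbb{R}^n$ with polynomial components such that $f(\mathbb{R}^m)=S$. *)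

theory Defs
  imports "HOL-Analysis.Analysis"
begin

definition recession_cone :: "'a::real_vector set \<Rightarrow> 'a set" where
  "recession_cone K = {v. \<forall>p\<in>K. \<forall>t\<ge>0. p + t *\<^sub>R v \<in> K}"

text \<open>The quantification over all base points is immaterial: on a polyhedron any single
  base point gives the same set.\<close>

lemma recession_cone_eq_at:
  fixes K :: "'a::euclidean_space set"
  assumes "polyhedron K" and p: "p \<in> K"
  shows "recession_cone K = {v. \<forall>t\<ge>0. p + t *\<^sub>R v \<in> K}"
proof -
  obtain F where F: "K = \<Inter>F" "\<And>h. h \<in> F \<Longrightarrow> \<exists>a b. a \<noteq> 0 \<and> h = {x. a \<bullet> x \<le> b}"
    using assms(1) unfolding polyhedron_def by blast
  have "q + t *\<^sub>R v \<in> K" if v: "\<forall>t\<ge>0. p + t *\<^sub>R v \<in> K" and q: "q \<in> K" and t: "t \<ge> 0" for q v t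
  proof -
    have "q + t *\<^sub>R v \<in> h" if h: "h \<in> F" for h
    proof -
      obtain a b where ab: "h = {x. a \<bullet> x \<le> b}" using F(2)[OF h] by blast
      have le: "a \<bullet> p + s * (a \<bullet> v) \<le> b" if "s \<ge> 0" for s
        using v that h unfolding F(1) ab by (force simp: ab inner_add_right)
      have "a \<bullet> v \<le> 0"
      proof (rule ccontr)
        assume "\<not> a \<bullet> v \<le> 0"
        then have pos: "a \<bullet> v > 0" by simp
        define s where "s = (\<bar>b - a \<bullet> p\<bar> + 1) / (a \<bullet> v)"
        have "s \<ge> 0" "s * (a \<bullet> v) = \<bar>b - a \<bullet> p\<bar> + 1" using pos by (auto simp: s_def)
        then show False using le[of s] by linarith
      qed
      then have "t * (a \<bullet> v) \<le> 0" using t by (simp add: mult_nonneg_nonpos)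
      moreover have "a \<bullet> q \<le> b" using q h unfolding F(1) by (auto simp: ab)
      ultimately show ?thesis by (simp add: ab inner_add_right)
    qed
    then show ?thesis unfolding F(1) by blast
  qed
  then show ?thesis using p unfolding recession_cone_def by blast
qed

definition orth_proj :: "'a::euclidean_space set \<Rightarrow> 'a \<Rightarrow> 'a" where
  "orth_proj V x = (THE y. y \<in> V \<and> (\<forall>w\<in>V. orthogonal (x - y) w))"

lemma orth_proj_iff:
  fixes V :: "'a::euclidean_space set"
  assumes V: "subspace V"
  shows "orth_proj V x = y \<longleftrightarrow> y \<in> V \<and> (\<forall>w\<in>V. orthogonal (x - y) w)"
proof -
  obtain u z where u: "u \<in> span V" and z: "\<And>w. w \<in> span V \<Longrightarrow> orthogonal z w" and x: "x = u + z"
    using orthogonal_subspace_decomp_exists[of V x] by metis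
  have sV: "span V = V" using V by (simp add: span_eq_iff)
  have ex: "u \<in> V \<and> (\<forall>w\<in>V. orthogonal (x - u) w)" using u z x sV by auto
  have uniq: "y = u" if y: "y \<in> V \<and> (\<forall>w\<in>V. orthogonal (x - y) w)" for y
  proof -
    have d: "y - u \<in> V" using y ex V by (simp add: subspace_diff)
    then have "(x - u) \<bullet> (y - u) = 0" "(x - y) \<bullet> (y - u) = 0"
      using y ex by (auto simp: orthogonal_def)
    then have "(y - u) \<bullet> (y - u) = 0" by (simp add: inner_diff_left)
    then show ?thesis by simp
  qed
  have "orth_proj V x = u" unfolding orth_proj_def using ex uniq by (rule the_equality)
  then show ?thesis using ex uniq by metis
qed

definition has_bounded_nonsingleton_projection :: "'a::euclidean_space set \<Rightarrow> bool" where
  "has_bounded_nonsingleton_projection S \<longleftrightarrow>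
     (\<exists>V. subspace V \<and> V \<noteq> {0} \<and> bounded (orth_proj V ` S) \<and>
          (\<exists>x \<in> orth_proj V ` S. \<exists>y \<in> orth_proj V ` S. x \<noteq> y))"

text \<open>The index type \<open>'m\<close> stands for the exponent \<open>m = CARD('m) \<ge> 1\<close> of the source space.\<close>

definition polynomial_image_of :: "'m::finite itself \<Rightarrow> (real^'n) set \<Rightarrow> bool" where
  "polynomial_image_of _ S \<longleftrightarrow>
     (\<exists>f :: real^'m \<Rightarrow> real^'n. (\<forall>i. real_polynomial_function (\<lambda>x. f x $ i)) \<and> range f = S)"

end

theory Submission
  imports Defs
begin

text \<open>
  Both projections come from one normal vector of \<^term>\<open>K\<close>.  Write \<^term>\<open>K\<close> as the set of
  \<^term>\<open>x\<close> with \<open>a \<bullet> x \<le> b\<^sub>a\<close>, for \<open>a\<close> in a finite set of normals.  A vector having negative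
  inner product with every normal is interior to the recession cone, so a recession cone of
  smaller dimension excludes such a vector.  By Gordan's alternative (lemma
  \<open>zero_in_convex_hull_or_negative_vector\<close>), \<open>0\<close> is then a convex combination of the normals, and
  a normal \<open>w\<close> with a positive coefficient in it is a nonpositive combination of the other
  normals, hence bounded below on \<^term>\<open>K\<close> as well as above.  The projection onto the line of \<open>w\<close>
  is therefore bounded on \<^term>\<open>K\<close>; it is not constant because the interior of \<^term>\<open>K\<close> is a
  nonempty open set and \<open>w \<noteq> 0\<close>.

  If a set on which the form of \<open>w\<close> is bounded and not constant were the image of a polynomial
  map \<open>f\<close>, then \<open>x \<mapsto> w \<bullet> f x\<close> would be a bounded
  real polynomial that takes two values.  Restriction to a line through two points where the
  values differ gives a bounded nonconstant polynomial in one variable, which does not exist.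
\<close>

section \<open>Bounded projections and bounded linear forms\<close>

text \<open>A single linear form suffices: given a projection onto any subspace, the difference of two
  distinct points of the image lies in that subspace, and its inner product factors through the
  projection and separates the two points.\<close>

lemma has_bounded_nonsingleton_projection_iff_inner:
  fixes S :: "'a::euclidean_space set"
  shows "has_bounded_nonsingleton_projection S \<longleftrightarrow>
    (\<exists>w. bounded ((\<bullet>) w ` S) \<and> (\<exists>x\<in>S. \<exists>y\<in>S. w \<bullet> x \<noteq> w \<bullet> y))"
proof
  assume "has_bounded_nonsingleton_projection S"
  then obtain V x y where V: "subspace V" and bd: "bounded (orth_proj V ` S)"
    and xy: "x \<in> S" "y \<in> S" "orth_proj V x \<noteq> orth_proj V y"
    unfolding has_bounded_nonsingleton_projection_def by auto
  define w where "w = orth_proj V x - orth_proj V y"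
  have proj: "orth_proj V z \<in> V" "\<And>v. v \<in> V \<Longrightarrow> (z - orth_proj V z) \<bullet> v = 0" for z
    using orth_proj_iff[OF V, of z] by (auto simp: orthogonal_def)
  have wV: "w \<in> V"
    using V proj(1) by (simp add: w_def subspace_diff)
  have factor: "w \<bullet> z = w \<bullet> orth_proj V z" for z
    using proj(2)[OF wV, of z] by (simp add: inner_diff_left inner_commute[of w])
  have "(\<bullet>) w ` S = (\<bullet>) w ` orth_proj V ` S"
    using factor by (auto simp: image_image)
  then have "bounded ((\<bullet>) w ` S)"
    using bounded_linear_image[OF bd bounded_linear_inner_right] by simp
  moreover have "w \<bullet> x - w \<bullet> y = w \<bullet> w"
    unfolding factor[of x] factor[of y] by (simp add: w_def inner_diff_right)
  then have "w \<bullet> x \<noteq> w \<bullet> y"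
    using xy(3) by (auto simp: w_def)
  ultimately show "\<exists>w. bounded ((\<bullet>) w ` S) \<and> (\<exists>x\<in>S. \<exists>y\<in>S. w \<bullet> x \<noteq> w \<bullet> y)"
    using xy(1,2) by blast
next
  assume "\<exists>w. bounded ((\<bullet>) w ` S) \<and> (\<exists>x\<in>S. \<exists>y\<in>S. w \<bullet> x \<noteq> w \<bullet> y)"
  then obtain w x y where bd: "bounded ((\<bullet>) w ` S)"
    and xy: "x \<in> S" "y \<in> S" "w \<bullet> x \<noteq> w \<bullet> y"
    by blast
  have w: "w \<noteq> 0"
    using xy(3) by auto
  have proj: "orth_proj (span {w}) z = (w \<bullet> z / (w \<bullet> w)) *\<^sub>R w" for z
    unfolding orth_proj_iff[OF subspace_span] using w
    by (auto simp: span_singleton orthogonal_def inner_diff_left inner_commute[of z])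
  have "orth_proj (span {w}) ` S = (\<lambda>r. (r / (w \<bullet> w)) *\<^sub>R w) ` (\<bullet>) w ` S"
    by (auto simp: proj image_image)
  moreover have "bounded_linear (\<lambda>r. (r / (w \<bullet> w)) *\<^sub>R w)"
    by (intro bounded_linear_scaleR_const bounded_linear_divide)
  ultimately have "bounded (orth_proj (span {w}) ` S)"
    using bounded_linear_image[OF bd] by simp
  moreover have "span {w} \<noteq> {0}"
    using w by (metis insertI1 singletonD span_base)
  moreover have "orth_proj (span {w}) x \<noteq> orth_proj (span {w}) y"
    using xy(3) w by (simp add: proj)
  ultimately show "has_bounded_nonsingleton_projection S"
    unfolding has_bounded_nonsingleton_projection_def
    using xy(1,2) by (intro exI[of _ "span {w}"]) auto
qed

lemma inner_not_constant_on_open: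
  fixes S :: "'a::euclidean_space set"
  assumes "open S" and "S \<noteq> {}" and "w \<noteq> 0"
  shows "\<exists>x\<in>S. \<exists>y\<in>S. w \<bullet> x \<noteq> w \<bullet> y"
proof -
  obtain x where x: "x \<in> S"
    using assms(2) by blast
  then obtain e where e: "e > 0" "cball x e \<subseteq> S"
    using assms(1) open_contains_cball by blast
  define y where "y = x + (e / norm w) *\<^sub>R w"
  have "y \<in> cball x e"
    using assms(3) e(1) by (simp add: y_def dist_norm)
  moreover have "w \<bullet> y - w \<bullet> x = (e / norm w) * (w \<bullet> w)"
    by (simp add: y_def inner_add_right)
  then have "w \<bullet> y \<noteq> w \<bullet> x"
    using assms(3) e(1) by auto
  ultimately show ?thesis
    using x e(2) by blast
qed

section \<open>A normal that is bounded on the polyhedron\<close>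

text \<open>Gordan's alternative.  The convex hull of a finite set is compact, so if it misses the origin
  then a hyperplane strictly separates it from the origin, and the normal of that hyperplane
  pointing away from the hull is the required vector.\<close>

lemma zero_in_convex_hull_or_negative_vector:
  fixes A :: "'a::euclidean_space set"
  assumes "finite A"
  shows "0 \<in> convex hull A \<or> (\<exists>v. \<forall>a\<in>A. a \<bullet> v < 0)"
proof (rule disjCI)
  assume neg: "\<not> (\<exists>v. \<forall>a\<in>A. a \<bullet> v < 0)"
  show "0 \<in> convex hull A"
  proof (rule ccontr)
    assume "0 \<notin> convex hull A"
    then obtain v b where "0 < b" "\<forall>x\<in>convex hull A. v \<bullet> x > b"
      using separating_hyperplane_closed_0[of "convex hull A"] assms
      by (auto simp: finite_imp_compact_convex_hull compact_imp_closed)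
    then have "\<forall>a\<in>A. a \<bullet> (- v) < 0"
      using hull_inc[of _ A] by (force simp: inner_commute)
    then show False
      using neg by blast
  qed
qed

text \<open>In a convex combination of \<^term>\<open>A\<close> equal to \<open>0\<close>, a vector with a positive coefficient is a
  nonpositive combination of the others, so their upper bounds turn into a lower bound for it.\<close>

lemma bounded_inner_if_zero_in_convex_hull:
  fixes A K :: "'a::euclidean_space set"
  assumes "finite A" and "0 \<in> convex hull A"
    and bdd: "\<And>a. a \<in> A \<Longrightarrow> \<exists>b. \<forall>x\<in>K. a \<bullet> x \<le> b"
  shows "\<exists>w\<in>A. bounded ((\<bullet>) w ` K)"
proof -
  obtain u where u: "\<forall>a\<in>A. 0 \<le> u a" "sum u A = 1" "(\<Sum>a\<in>A. u a *\<^sub>R a) = 0"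
    using assms(2) unfolding convex_hull_finite[OF assms(1)] by blast
  obtain w where w: "w \<in> A" "u w > 0"
    using u(1,2) by (metis less_eq_real_def sum.neutral zero_neq_one)
  obtain b where b: "\<And>a x. a \<in> A \<Longrightarrow> x \<in> K \<Longrightarrow> a \<bullet> x \<le> b a"
    using bdd by metis
  define c where "c = (\<Sum>a\<in>A - {w}. u a * b a)"
  have lower: "- c / u w \<le> w \<bullet> x" if x: "x \<in> K" for x
  proof -
    have "0 = (\<Sum>a\<in>A. u a *\<^sub>R a) \<bullet> x"
      by (simp add: u(3))
    also have "\<dots> = (\<Sum>a\<in>A. u a * (a \<bullet> x))"
      by (simp add: inner_sum_left)
    also have "\<dots> = u w * (w \<bullet> x) + (\<Sum>a\<in>A - {w}. u a * (a \<bullet> x))"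
      using assms(1) w(1) by (rule sum.remove)
    also have "(\<Sum>a\<in>A - {w}. u a * (a \<bullet> x)) \<le> c"
      unfolding c_def using u(1) b x by (intro sum_mono mult_left_mono) auto
    finally have "- c \<le> w \<bullet> x * u w"
      by (simp add: mult.commute)
    then show ?thesis
      using w(2) by (simp only: pos_divide_le_eq)
  qed
  have "(\<bullet>) w ` K \<subseteq> {- c / u w..b w}"
    using lower b[OF w(1)] by auto
  then show ?thesis
    using w(1) bounded_subset bounded_closed_interval by blast
qed

text \<open>The strict inequalities cut out an open subset of the recession cone.\<close>

lemma aff_dim_recession_cone_full:
  fixes F :: "'a::euclidean_space set set"
  assumes F: "finite F" "\<And>h. h \<in> F \<Longrightarrow> h = {x. a h \<bullet> x \<le> b h}"
    and v: "\<forall>h\<in>F. a h \<bullet> v < 0"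
  shows "aff_dim (recession_cone (\<Inter>F)) = int DIM('a)"
proof -
  define U where "U = (\<Inter>h\<in>F. {z. a h \<bullet> z < 0})"
  have "open U"
    unfolding U_def using F(1) by (intro open_INT) (auto intro: open_halfspace_lt)
  moreover have "v \<in> U"
    using v by (simp add: U_def)
  moreover have "U \<subseteq> recession_cone (\<Inter>F)"
  proof -
    have "p + t *\<^sub>R z \<in> h" if z: "z \<in> U" and p: "p \<in> \<Inter>F" and t: "t \<ge> 0" and h: "h \<in> F" for z p t h
    proof -
      have "a h \<bullet> p \<le> b h"
        using p h F(2)[OF h] by blast
      moreover have "t * (a h \<bullet> z) \<le> 0"
        using z h t by (intro mult_nonneg_nonpos) (auto simp: U_def intro: less_imp_le)
      ultimately have "a h \<bullet> (p + t *\<^sub>R z) \<le> b h"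
        by (simp add: inner_add_right)
      then show ?thesis
        using F(2)[OF h] by blast
    qed
    then show ?thesis
      unfolding recession_cone_def by blast
  qed
  ultimately have "v \<in> interior (recession_cone (\<Inter>F))"
    by (rule interiorI)
  then show ?thesis
    by (intro aff_dim_nonempty_interior) blast
qed

lemma polyhedron_bounded_inner:
  fixes K :: "'a::euclidean_space set"
  assumes "polyhedron K" and "aff_dim (recession_cone K) < int DIM('a)"
  shows "\<exists>w. w \<noteq> 0 \<and> bounded ((\<bullet>) w ` K)"
proof -
  obtain F where F: "finite F" "K = \<Inter>F" "\<forall>h\<in>F. \<exists>a b. a \<noteq> 0 \<and> h = {x. a \<bullet> x \<le> b}"
    using assms(1) unfolding polyhedron_def by blast
  then obtain a b where ab: "\<And>h. h \<in> F \<Longrightarrow> a h \<noteq> 0" "\<And>h. h \<in> F \<Longrightarrow> h = {x. a h \<bullet> x \<le> b h}"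
    by metis
  have "\<not> (\<exists>v. \<forall>h\<in>F. a h \<bullet> v < 0)"
    using aff_dim_recession_cone_full[OF F(1) ab(2)] assms(2) F(2) by auto
  then have zero: "0 \<in> convex hull (a ` F)"
    using zero_in_convex_hull_or_negative_vector[of "a ` F"] F(1) by auto
  have upper: "\<exists>\<beta>. \<forall>x\<in>K. c \<bullet> x \<le> \<beta>" if "c \<in> a ` F" for c
    using that ab(2) F(2) by blast
  show ?thesis
    using bounded_inner_if_zero_in_convex_hull[OF _ zero upper] F(1) ab(1) by blast
qed

section \<open>Polynomial images\<close>

text \<open>On a line a polynomial function is a polynomial in one variable, and if some coefficient of
  positive degree is nonzero, then its absolute value tends to infinity.\<close>

lemma bounded_real_polynomial_function_constant:
  fixes p :: "'a::real_normed_vector \<Rightarrow> real"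
  assumes p: "real_polynomial_function p" and bd: "bounded (range p)"
  shows "p x = p y"
proof -
  define q where "q = p \<circ> (\<lambda>t. x + t *\<^sub>R (y - x))"
  have "polynomial_function (\<lambda>t::real. x + t *\<^sub>R (y - x))"
    by (intro polynomial_function_add polynomial_function_const
        polynomial_function_bounded_linear bounded_linear_scaleR_left)
  then have "real_polynomial_function q"
    unfolding q_def using p by (rule real_polynomial_function_compose)
  then obtain c n where c: "q = (\<lambda>t. \<Sum>i\<le>n. c i * t ^ i)"
    unfolding real_polynomial_function_iff_sum by blast
  obtain B where B: "\<And>z. \<bar>p z\<bar> \<le> B"
    using bd unfolding bounded_iff by auto
  have "c k = 0" if "k \<noteq> 0" "k \<le> n" for k
  proof (rule ccontr)
    assume "c k \<noteq> 0"
    then have "eventually (\<lambda>t. norm (\<Sum>i\<le>n. c i * t ^ i) \<ge> B + 1) at_infinity"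
      using that by (intro polyfun_extremal) blast
    then obtain t where "B + 1 \<le> \<bar>q t\<bar>"
      unfolding c real_norm_def
      using eventually_happens trivial_limit_at_infinity by blast
    then show False
      using B[of "x + t *\<^sub>R (y - x)"] by (simp add: q_def)
  qed
  then have "q t = c 0" for t
    unfolding c by (subst sum.remove[of _ 0]) (auto intro!: sum.neutral)
  from this[of 0] this[of 1] show ?thesis
    by (simp add: q_def)
qed

lemma polynomial_image_no_bounded_nonsingleton_projection:
  fixes S :: "(real^'n) set"
  assumes "polynomial_image_of TYPE('m::finite) S"
  shows "\<not> has_bounded_nonsingleton_projection S"
proof
  assume "has_bounded_nonsingleton_projection S"
  then obtain w x y where bd: "bounded ((\<bullet>) w ` S)"
    and xy: "x \<in> S" "y \<in> S" "w \<bullet> x \<noteq> w \<bullet> y"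
    unfolding has_bounded_nonsingleton_projection_iff_inner by blast
  obtain f :: "real^'m \<Rightarrow> real^'n"
    where f: "\<And>i. real_polynomial_function (\<lambda>z. f z $ i)" "range f = S"
    using assms unfolding polynomial_image_of_def by blast
  have "real_polynomial_function (\<lambda>z. w \<bullet> f z)"
    unfolding inner_vec_def inner_real_def
    by (intro real_polynomial_function_sum real_polynomial_function.intros(2,4) f(1)) simp
  moreover have "bounded (range (\<lambda>z. w \<bullet> f z))"
    using bd by (simp add: image_image flip: f(2))
  ultimately have "w \<bullet> f z = w \<bullet> f z'" for z z'
    by (rule bounded_real_polynomial_function_constant)
  then show False
    using xy unfolding f(2)[symmetric] by blast
qed

section \<open>Polyhedra with a recession cone of smaller dimension\<close>

theorem proposition2p1:
  fixes K :: "(real^'n) set"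
  assumes "polyhedron K" and "K \<noteq> {}"
    and "aff_dim K = int CARD('n)"
    and "aff_dim (recession_cone K) < int CARD('n)"
  shows "has_bounded_nonsingleton_projection K \<and>
         has_bounded_nonsingleton_projection (rel_interior K) \<and>
         \<not> polynomial_image_of TYPE('m::finite) K \<and>
         \<not> polynomial_image_of TYPE('m::finite) (rel_interior K)"
proof -
  have "affine hull K = UNIV"
    using assms(3) aff_dim_eq_full[of K] by simp
  then have "rel_interior K = interior K"
    by (rule rel_interior_interior)
  then have "open (rel_interior K)"
    by simp
  moreover have "rel_interior K \<noteq> {}"
    using assms(1,2) by (simp add: rel_interior_eq_empty polyhedron_imp_convex)
  moreover obtain w where w: "w \<noteq> 0" "bounded ((\<bullet>) w ` K)"
    using polyhedron_bounded_inner[OF assms(1)] assms(4) by auto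
  ultimately obtain x y where xy: "x \<in> rel_interior K" "y \<in> rel_interior K" "w \<bullet> x \<noteq> w \<bullet> y"
    using inner_not_constant_on_open by metis
  have sub: "rel_interior K \<subseteq> K"
    by (rule rel_interior_subset)
  have K: "has_bounded_nonsingleton_projection K"
    unfolding has_bounded_nonsingleton_projection_iff_inner using w(2) xy sub by blast
  have "bounded ((\<bullet>) w ` rel_interior K)"
    using w(2) sub bounded_subset image_mono by metis
  then have Int: "has_bounded_nonsingleton_projection (rel_interior K)"
    unfolding has_bounded_nonsingleton_projection_iff_inner using xy by blast
  show ?thesis
    using K Int polynomial_image_no_bounded_nonsingleton_projection by blast
qed

end
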